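(* Let $(X,\mathfrak{B},\mu)$ be a measure space, let $T:X\to X$ be a measurable transformation, and assume that $\mu$ is a $\sigma$-finite measure that is half-invariant by $T$. Then, for any non-negative $f\in\mathcal{L}^1(X,\mu)$, the following hold. (a) The limit $f^{*}(x)=\lim_{n\to\infty}\frac{1}{n}\sum_{j=0}^{n-1} f(T^j(x))$ exists for $\mu$-almost every point $x$. (b) The function $f^{*}$ is $\mu$-integrable and $T$-invariant. (c) $\int f^{*}\,d\mu\le\liminf_{n\to\infty}\frac{1}{n}\sum_{j=0}^{n-1}\int f\circ T^j\,d\mu\le\int f\,d\mu$. (d) If $\mu(X)<+\infty$, then $\int f^{*}\,d\mu=\lim_{n\to\infty}\frac{1}{n}\sum_{j=0}^{n-1}\int f\circ T^j\,d\mu=\int f\,d\mu$. (e) If $\mu(X)<+\infty$, then $\mu$ is $T$-invariant, i.e. $\mu(T^{-1}(B))=\mu(B)$ for every $B\in\mathfrak{B}$.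
   Context: A measure $\mu$ on a $\sigma$-algebra $\mathfrak{B}$ is half-invariant by a measurable map $T:X\to X$ if $\mu(T^{-1}(B))\le\mu(B)$ for every $B\in\mathfrak{B}$. The function $f^{*}$ is defined $\mu$-almost everywhere by the limit in (a), and $T$-invariance of $f^{*}$ means $f^{*}\circ T=f^{*}$ ($\mu$-almost everywhere). *)

theory Defs
  imports "HOL-Analysis.Analysis"
begin

text \<open>Measurability of \<open>T\<close> is not part of this definition; it is assumed separately.\<close>

definition half_invariant :: "'a measure \<Rightarrow> ('a \<Rightarrow> 'a) \<Rightarrow> bool" where
  "half_invariant M T \<longleftrightarrow> (\<forall>B\<in>sets M. emeasure M (T -` B \<inter> space M) \<le> emeasure M B)"

definition invariant_measure :: "'a measure \<Rightarrow> ('a \<Rightarrow> 'a) \<Rightarrow> bool" where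
  "invariant_measure M T \<longleftrightarrow> (\<forall>B\<in>sets M. emeasure M (T -` B \<inter> space M) = emeasure M B)"

definition birkhoff_average :: "('a \<Rightarrow> 'a) \<Rightarrow> ('a \<Rightarrow> real) \<Rightarrow> nat \<Rightarrow> 'a \<Rightarrow> real" where
  "birkhoff_average T f n x = 1 / real n * (\<Sum>j<n. f ((T ^^ j) x))"

text \<open>At points where the averages do not converge, \<^const>\<open>lim\<close> returns an unspecified
  value, the same for all such points; the value is irrelevant when these points form a
  null set.\<close>

definition birkhoff_limit :: "('a \<Rightarrow> 'a) \<Rightarrow> ('a \<Rightarrow> real) \<Rightarrow> 'a \<Rightarrow> real" where
  "birkhoff_limit T f x = lim (\<lambda>n. birkhoff_average T f n x)"

end

(* With S_n the Birkhoff sums of f, let B consist of the points where S_n - n a is unbounded below and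
   S_n - n b is unbounded above, for a < b and b > 0; it is forward invariant. Garsia's argument only
   needs that integral (g o T) <= integral g for g >= 0, so the maximal ergodic inequality survives
   half-invariance. Applied to f 1_B - b 1_C with C a subset of B of finite measure, it bounds mu(C),
   so sigma-finiteness gives mu(B) < infinity; applied to (f - b) 1_B and (a - f) 1_B it then
   gives b mu(B) <= integral over B of f <= a mu(B), hence mu(B) = 0. Fatou's lemma excludes
   infinite limits and gives (c). When mu is finite, it is invariant, and (d) follows from dominated
   convergence applied to the truncations min(f, k). *)
theory Submission
  imports Defs
begin

section \<open>Transfer of integrals and null sets along a half-invariant map\<close>

locale half_invariant_map =
  fixes M :: "'a measure" and T :: "'a \<Rightarrow> 'a"
  assumes T_measurable [measurable]: "T \<in> M \<rightarrow>\<^sub>M M"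
    and half_invariant: "half_invariant M T"
begin

lemma funpow_measurable [measurable]: "T ^^ n \<in> M \<rightarrow>\<^sub>M M"
  by (induction n) (auto simp: id_def)

lemma T_space: "x \<in> space M \<Longrightarrow> T x \<in> space M"
  using measurable_space[OF T_measurable] .

text \<open>Half-invariance says that the push-forward \<open>distr M M T\<close> lies below
  \<open>M\<close> in the order of measures, and nonnegative integrals are monotone in the
  measure.\<close>

lemma nn_integral_comp_le:
  assumes [measurable]: "h \<in> borel_measurable M"
  shows "(\<integral>\<^sup>+x. h (T x) \<partial>M) \<le> (\<integral>\<^sup>+x. h x \<partial>M)"
proof -
  have "distr M M T \<le> M"
    using half_invariant
    by (auto simp: le_measure emeasure_distr half_invariant_def)
  then have "(\<integral>\<^sup>+x. h x \<partial>distr M M T) \<le> (\<integral>\<^sup>+x. h x \<partial>M)"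
    by (intro nn_integral_mono_measure) auto
  then show ?thesis
    by (simp add: nn_integral_distr)
qed

lemma integrable_comp:
  fixes g :: "'a \<Rightarrow> real"
  assumes "integrable M g"
  shows "integrable M (\<lambda>x. g (T x))"
proof -
  have [measurable]: "g \<in> borel_measurable M"
    using assms by auto
  have "(\<integral>\<^sup>+x. norm (g (T x)) \<partial>M) \<le> (\<integral>\<^sup>+x. norm (g x) \<partial>M)"
    by (rule nn_integral_comp_le) simp
  also have "\<dots> < \<infinity>"
    using assms by (simp add: integrable_iff_bounded)
  finally show ?thesis
    by (simp add: integrable_iff_bounded)
qed

text \<open>The preimage of a null set has measure at most 0. This lets almost-everywhere hypotheses
  on \<open>f\<close> travel along whole orbits.\<close>

lemma AE_comp:
  assumes "AE x in M. P x"
  shows "AE x in M. P (T x)"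
proof -
  obtain N where N: "{x \<in> space M. \<not> P x} \<subseteq> N" "emeasure M N = 0" "N \<in> sets M"
    using AE_E[OF assms] by metis
  have "T -` N \<inter> space M \<in> null_sets M"
    using half_invariant N by (auto simp: half_invariant_def null_sets_def)
  moreover have "{x \<in> space M. \<not> P (T x)} \<subseteq> T -` N \<inter> space M"
    using N T_space by auto
  ultimately show ?thesis
    by (rule AE_I')
qed

text \<open>The sign condition is essential: an inequality valid for both \<open>g\<close> and
  \<open>-g\<close> would be an equality.\<close>

lemma integral_comp_le:
  fixes g :: "'a \<Rightarrow> real"
  assumes g: "integrable M g" and nonneg: "AE x in M. 0 \<le> g x"
  shows "(\<integral>x. g (T x) \<partial>M) \<le> (\<integral>x. g x \<partial>M)"
proof -
  have [measurable]: "g \<in> borel_measurable M"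
    using g by auto
  have "ennreal (\<integral>x. g (T x) \<partial>M) \<le> ennreal (\<integral>x. g x \<partial>M)"
    using nn_integral_comp_le[of "\<lambda>x. ennreal (g x)"]
    by (simp add: nn_integral_eq_integral g integrable_comp nonneg AE_comp[OF nonneg])
  then show ?thesis
    using integral_nonneg_AE[OF nonneg] by simp
qed

lemma integrable_funpow:
  fixes g :: "'a \<Rightarrow> real"
  assumes "integrable M g"
  shows "integrable M (\<lambda>x. g ((T ^^ j) x))"
proof (induction j)
  case (Suc j)
  then show ?case
    using integrable_comp by (simp add: funpow_swap1)
qed (simp add: assms)

lemma AE_funpow:
  assumes "AE x in M. P x"
  shows "AE x in M. P ((T ^^ j) x)"
proof (induction j)
  case (Suc j)
  from AE_comp[OF this] show ?case
    by (simp add: funpow_swap1)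
qed (simp add: assms)

lemma integral_funpow_le:
  fixes g :: "'a \<Rightarrow> real"
  assumes g: "integrable M g" and nonneg: "AE x in M. 0 \<le> g x"
  shows "(\<integral>x. g ((T ^^ j) x) \<partial>M) \<le> (\<integral>x. g x \<partial>M)"
proof (induction j)
  case (Suc j)
  have "(\<integral>x. g ((T ^^ j) (T x)) \<partial>M) \<le> (\<integral>x. g ((T ^^ j) x) \<partial>M)"
    using integral_comp_le[OF integrable_funpow[OF g] AE_funpow[OF nonneg]] .
  with Suc show ?case
    by (simp add: funpow_swap1)
qed simp

section \<open>Birkhoff sums and averages\<close>

definition birkhoff_sum :: "('a \<Rightarrow> real) \<Rightarrow> nat \<Rightarrow> 'a \<Rightarrow> real" where
  "birkhoff_sum g n x = (\<Sum>j<n. g ((T ^^ j) x))"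

lemma birkhoff_sum_0 [simp]: "birkhoff_sum g 0 x = 0"
  by (simp add: birkhoff_sum_def)

text \<open>Splitting off the first term rather than the last relates sums at \<open>x\<close> to
  sums at \<open>T x\<close>; the recursion of \<open>max_sum\<close> and the forward invariance of
  \<open>oscillation\<close> both rest on this form.\<close>

lemma birkhoff_sum_Suc: "birkhoff_sum g (Suc n) x = g x + birkhoff_sum g n (T x)"
  by (simp add: birkhoff_sum_def sum.lessThan_Suc_shift funpow_swap1 del: sum.lessThan_Suc)

lemma birkhoff_average_eq: "birkhoff_average T g n x = birkhoff_sum g n x / real n"
  by (simp add: birkhoff_average_def birkhoff_sum_def)

lemma birkhoff_sum_measurable [measurable]:
  assumes [measurable]: "g \<in> borel_measurable M"
  shows "birkhoff_sum g n \<in> borel_measurable M"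
  unfolding birkhoff_sum_def[abs_def] by measurable

lemma birkhoff_average_measurable [measurable]:
  assumes [measurable]: "g \<in> borel_measurable M"
  shows "birkhoff_average T g n \<in> borel_measurable M"
  unfolding birkhoff_average_eq[abs_def] by measurable

lemma birkhoff_limit_measurable [measurable]:
  assumes [measurable]: "g \<in> borel_measurable M"
  shows "birkhoff_limit T g \<in> borel_measurable M"
  unfolding birkhoff_limit_def[abs_def] by (rule borel_measurable_lim_metric) simp

lemma integrable_birkhoff_average:
  assumes "integrable M g"
  shows "integrable M (birkhoff_average T g n)"
  unfolding birkhoff_average_def[abs_def]
  by (intro integrable_mult_right Bochner_Integration.integrable_sum integrable_funpow assms)

lemma integral_birkhoff_average:
  assumes "integrable M g"
  shows "(\<integral>x. birkhoff_average T g n x \<partial>M) = 1 / real n * (\<Sum>j<n. \<integral>x. g ((T ^^ j) x) \<partial>M)"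
  unfolding birkhoff_average_def using integrable_funpow[OF assms] by simp

lemma AE_birkhoff_average_nonneg:
  assumes "AE x in M. 0 \<le> g x"
  shows "AE x in M. \<forall>n. 0 \<le> birkhoff_average T g n x"
proof -
  have "AE x in M. \<forall>j. 0 \<le> g ((T ^^ j) x)"
    using AE_funpow[OF assms] by (simp add: AE_all_countable)
  then show ?thesis
    by eventually_elim (simp add: birkhoff_average_def sum_nonneg)
qed

lemma integral_birkhoff_average_le:
  assumes g: "integrable M g" and nonneg: "AE x in M. 0 \<le> g x"
  shows "(\<integral>x. birkhoff_average T g n x \<partial>M) \<le> (\<integral>x. g x \<partial>M)"
proof (cases "n = 0")
  case True
  \<comment> \<open>Division by zero yields 0, so the average of length 0 vanishes and only the sign
    of the right-hand side matters.\<close>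
  then show ?thesis
    using integral_nonneg_AE[OF nonneg] by (simp add: birkhoff_average_def)
next
  case False
  have "(\<Sum>j<n. \<integral>x. g ((T ^^ j) x) \<partial>M) \<le> (\<Sum>j<n. \<integral>x. g x \<partial>M)"
    by (intro sum_mono integral_funpow_le g nonneg)
  with False show ?thesis
    by (simp add: integral_birkhoff_average[OF g] field_simps)
qed

subsection \<open>The maximal ergodic inequality\<close>

text \<open>The maximum of the Birkhoff sums of length at most \<open>n\<close>, the empty sum included.\<close>

fun max_sum :: "('a \<Rightarrow> real) \<Rightarrow> nat \<Rightarrow> 'a \<Rightarrow> real" where
  "max_sum g 0 x = 0"
| "max_sum g (Suc n) x = max 0 (g x + max_sum g n (T x))"

lemma max_sum_nonneg: "0 \<le> max_sum g n x"
  by (cases n) auto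

lemma max_sum_mono_Suc: "max_sum g n x \<le> max_sum g (Suc n) x"
proof (induction n arbitrary: x)
  case (Suc n)
  from Suc[of "T x"] show ?case by auto
qed simp

lemma birkhoff_sum_le_max_sum: "birkhoff_sum g n x \<le> max_sum g n x"
proof (induction n arbitrary: x)
  case (Suc n)
  from Suc[of "T x"] show ?case by (simp add: birkhoff_sum_Suc)
qed simp

lemma integrable_max_sum:
  assumes g: "integrable M g"
  shows "integrable M (max_sum g n)"
proof (induction n)
  case (Suc n)
  have "integrable M (\<lambda>x. max 0 (g x + max_sum g n (T x)))"
    by (intro integrable_max integrable_zero Bochner_Integration.integrable_add g
        integrable_comp[OF Suc])
  then show ?case by simp
next
  case 0
  have "integrable M (\<lambda>x. 0::real)" by simp
  then show ?case by simp
qed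

text \<open>Garsia's argument: integrate \<open>max_sum g n x - max_sum g n (T x)\<close>, which is
  at most \<open>g x\<close> where \<open>max_sum g n\<close> is positive and at most 0 elsewhere.
  Assumption \<open>ex\<close> says that these positivity sets eventually cover the support of
  \<open>g\<close>, so that \<open>g\<close> may be a function cut off to a forward invariant
  set.\<close>

lemma maximal_ergodic_inequality:
  assumes g: "integrable M g"
    and ex: "\<And>x. x \<in> space M \<Longrightarrow> g x \<noteq> 0 \<Longrightarrow> \<exists>n. 0 < birkhoff_sum g n x"
  shows "0 \<le> (\<integral>x. g x \<partial>M)"
proof -
  have [measurable]: "g \<in> borel_measurable M"
    using g by auto
  have [measurable]: "max_sum g n \<in> borel_measurable M" for n
    using integrable_max_sum[OF g] by auto
  define h where "h n x = (if 0 < max_sum g n x then g x else 0)" for n x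
  have [measurable]: "h n \<in> borel_measurable M" for n
    unfolding h_def[abs_def] by measurable
  have h_int: "integrable M (h n)" for n
    by (rule Bochner_Integration.integrable_bound[OF g]) (auto simp: h_def)
  have "0 \<le> (\<integral>x. h n x \<partial>M)" for n
  proof -
    note int = integrable_max_sum[OF g, of n]
    \<comment> \<open>A positive maximum comes from a nonempty sum, hence equals \<open>g x\<close>
      plus a maximum of level \<open>n - 1\<close> at \<open>T x\<close>, which the level
      \<open>n\<close> only enlarges. Otherwise the maximum at \<open>x\<close> is 0 and the one at
      \<open>T x\<close> is nonnegative.\<close>
    have "max_sum g n x - max_sum g n (T x) \<le> h n x" for x
    proof (cases "0 < max_sum g n x")
      case True
      then obtain m where n: "n = Suc m" by (cases n) auto
      with True have "max_sum g n x = g x + max_sum g m (T x)" by (auto simp: max_def split: if_splits)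
      also have "\<dots> \<le> g x + max_sum g n (T x)"
        using max_sum_mono_Suc n by simp
      finally show ?thesis using True by (simp add: h_def)
    next
      case False
      then show ?thesis
        using max_sum_nonneg[of g n "T x"] by (simp add: h_def)
    qed
    then have "(\<integral>x. max_sum g n x - max_sum g n (T x) \<partial>M) \<le> (\<integral>x. h n x \<partial>M)"
      by (intro integral_mono Bochner_Integration.integrable_diff int integrable_comp h_int)
    \<comment> \<open>Half-invariance points in the needed direction because \<open>max_sum\<close>
      is nonnegative; hence the left side of the previous inequality is nonnegative.\<close>
    moreover have "(\<integral>x. max_sum g n (T x) \<partial>M) \<le> (\<integral>x. max_sum g n x \<partial>M)"
      by (intro integral_comp_le int AE_I2 max_sum_nonneg)
    ultimately show ?thesis
      by (simp add: int integrable_comp[OF int])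
  qed
  moreover have "(\<lambda>n. \<integral>x. h n x \<partial>M) \<longlonglongrightarrow> (\<integral>x. g x \<partial>M)"
  proof (rule integral_dominated_convergence)
    show "integrable M (\<lambda>x. \<bar>g x\<bar>)" using g by simp
    show "AE x in M. (\<lambda>n. h n x) \<longlonglongrightarrow> g x"
    proof (rule AE_I2)
      fix x assume x: "x \<in> space M"
      show "(\<lambda>n. h n x) \<longlonglongrightarrow> g x"
      proof (cases "g x = 0")
        case True
        then have "(\<lambda>n. h n x) = (\<lambda>n. g x)" by (auto simp: h_def)
        then show ?thesis by simp
      next
        case False
        with ex x obtain k where k: "0 < birkhoff_sum g k x" by blast
        \<comment> \<open>A single positive sum of length \<open>k\<close> keeps all later maxima
          positive, so the cut-off disappears from \<open>k\<close> on.\<close>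
        have "h n x = g x" if "k \<le> n" for n
        proof -
          have "max_sum g k x \<le> max_sum g n x"
            using lift_Suc_mono_le[of "\<lambda>n. max_sum g n x"] max_sum_mono_Suc that by blast
          then have "0 < max_sum g n x"
            using k birkhoff_sum_le_max_sum[of g k x] by linarith
          then show ?thesis by (simp add: h_def)
        qed
        then show ?thesis
          by (intro tendsto_eventually) (auto simp: eventually_sequentially)
      qed
    qed
  qed (auto simp: h_def)
  ultimately show ?thesis
    by (intro LIMSEQ_le_const) auto
qed

subsection \<open>Almost everywhere convergence\<close>

text \<open>Asking for unbounded deviations, rather than for \<open>liminf < a < b < limsup\<close> of the averages,
  makes forward invariance immediate from \<open>birkhoff_sum_Suc\<close>.\<close>

definition oscillation :: "('a \<Rightarrow> real) \<Rightarrow> real \<Rightarrow> real \<Rightarrow> 'a set" where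
  "oscillation f a b = {x \<in> space M.
     (\<forall>K::nat. \<exists>n. birkhoff_sum f n x + real K < real n * a) \<and>
     (\<forall>K::nat. \<exists>n. real n * b + real K < birkhoff_sum f n x)}"

text \<open>Both \<open>K\<close> and \<open>n\<close> range over the naturals, so the set is built
  from measurable sets by countable operations.\<close>

lemma oscillation_sets [measurable]:
  assumes [measurable]: "f \<in> borel_measurable M"
  shows "oscillation f a b \<in> sets M"
  unfolding oscillation_def by measurable

lemma oscillation_T:
  assumes x: "x \<in> oscillation f a b"
  shows "T x \<in> oscillation f a b"
proof -
  have "\<exists>n. birkhoff_sum f n (T x) + real K < real n * a" for K :: nat
  proof -
    \<comment> \<open>Passing from length \<open>Suc m\<close> at \<open>x\<close> to length
      \<open>m\<close> at \<open>T x\<close> drops the term \<open>f x\<close> and one multiple of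
      \<open>a\<close>; \<open>L\<close> pays for both and leaves \<open>K\<close>.\<close>
    obtain L :: nat where L: "real K + \<bar>f x\<bar> + \<bar>a\<bar> < real L"
      using reals_Archimedean2 by blast
    obtain n where n: "birkhoff_sum f n x + real L < real n * a"
      using x by (auto simp: oscillation_def)
    \<comment> \<open>Length 0 is impossible: the strict inequality would read
      \<open>real L < 0\<close>.\<close>
    then obtain m where "n = Suc m" by (cases n) auto
    with n L show ?thesis
      by (intro exI[of _ m]) (auto simp: birkhoff_sum_Suc algebra_simps)
  qed
  moreover have "\<exists>n. real n * b + real K < birkhoff_sum f n (T x)" for K :: nat
  proof -
    obtain L :: nat where L: "real K + \<bar>f x\<bar> + \<bar>b\<bar> < real L"
      using reals_Archimedean2 by blast
    obtain n where n: "real n * b + real L < birkhoff_sum f n x"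
      using x by (auto simp: oscillation_def)
    then obtain m where "n = Suc m" by (cases n) auto
    with n L show ?thesis
      by (intro exI[of _ m]) (auto simp: birkhoff_sum_Suc algebra_simps)
  qed
  ultimately show ?thesis
    using x T_space by (simp add: oscillation_def)
qed

lemma oscillation_funpow: "x \<in> oscillation f a b \<Longrightarrow> (T ^^ j) x \<in> oscillation f a b"
  by (induction j) (auto intro: oscillation_T)

text \<open>The set \<open>C\<close> stands in for the whole oscillation set, whose measure is not
  yet known to be finite: only a constant on a set of finite measure is integrable. The right-hand
  side does not depend on \<open>C\<close>.\<close>

lemma oscillation_finite_part:
  assumes f: "integrable M f" and b: "0 < b"
    and C: "C \<in> sets M" "C \<subseteq> oscillation f a b" "emeasure M C < \<infinity>"
  shows "b * measure M C \<le> (\<integral>x. f x * indicator (oscillation f a b) x \<partial>M)"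
proof -
  let ?B = "oscillation f a b"
  have [measurable]: "f \<in> borel_measurable M" using f by auto
  have fB: "integrable M (\<lambda>x. f x * indicator ?B x)"
    using f by (intro integrable_real_mult_indicator) auto
  have C_int: "integrable M (\<lambda>x. b * indicator C x)"
    using C by (intro integrable_mult_right integrable_real_indicator) auto
  let ?g = "\<lambda>x. f x * indicator ?B x - b * indicator C x"
  have "0 \<le> (\<integral>x. ?g x \<partial>M)"
  proof (rule maximal_ergodic_inequality)
    fix x assume "?g x \<noteq> 0"
    then have x: "x \<in> ?B" using C by (auto split: split_indicator_asm)
    then obtain n where n: "real n * b + real 0 < birkhoff_sum f n x"
      unfolding oscillation_def by blast
    \<comment> \<open>The orbit stays in \<open>?B\<close>, so \<open>f\<close> is never cut off,
      while at most \<open>b\<close> is subtracted at each time; this uses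
      \<open>0 < b\<close>.\<close>
    have "(\<Sum>j<n. f ((T ^^ j) x) - b) \<le> birkhoff_sum ?g n x"
      unfolding birkhoff_sum_def using oscillation_funpow[OF x] b
      by (intro sum_mono) (auto split: split_indicator)
    then have "0 < birkhoff_sum ?g n x"
      using n by (simp add: birkhoff_sum_def sum_subtractf)
    then show "\<exists>n. 0 < birkhoff_sum ?g n x" ..
  qed (intro Bochner_Integration.integrable_diff fB C_int)
  then show ?thesis
    using fB C_int C by simp
qed

text \<open>Once the measure of the set is known to be finite, the integral of \<open>f\<close> over
  it lies between \<open>b\<close> and \<open>a\<close> times that measure from below and above
  respectively, which with \<open>a < b\<close> leaves only measure 0.\<close>

lemma oscillation_null:
  assumes M: "sigma_finite_measure M" and f: "integrable M f" and ab: "0 < b" "a < b"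
  shows "oscillation f a b \<in> null_sets M"
proof -
  let ?B = "oscillation f a b"
  have [measurable]: "f \<in> borel_measurable M" using f by auto
  have fB: "integrable M (\<lambda>x. f x * indicator ?B x)"
    using f by (intro integrable_real_mult_indicator) auto
  define c where "c = (\<integral>x. f x * indicator ?B x \<partial>M)"
  obtain A :: "nat \<Rightarrow> 'a set" where A: "range A \<subseteq> sets M" "(\<Union>i. A i) = space M"
      "\<And>i. emeasure M (A i) \<noteq> \<infinity>" "incseq A"
    using sigma_finite_measure.sigma_finite_incseq[OF M] by blast
  have A_sets [measurable]: "A i \<in> sets M" for i using A by auto
  \<comment> \<open>The bound is uniform in \<open>i\<close>, so it survives the exhaustion of the
    space by the sets \<open>A i\<close>.\<close>
  have le: "emeasure M (?B \<inter> A i) \<le> ennreal (c / b)" for i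
  proof -
    have fin: "emeasure M (?B \<inter> A i) < \<infinity>"
      using emeasure_mono[of "?B \<inter> A i" "A i" M] A(3)[of i]
      by (auto simp: less_top top_unique)
    then have "b * measure M (?B \<inter> A i) \<le> c"
      unfolding c_def by (intro oscillation_finite_part f ab) auto
    then have "measure M (?B \<inter> A i) \<le> c / b"
      using ab by (simp add: field_simps)
    then show ?thesis
      using fin by (simp add: emeasure_eq_ennreal_measure ennreal_leI less_top)
  qed
  have "(\<Union>i. ?B \<inter> A i) = ?B"
    using A(2) by (auto simp: oscillation_def)
  moreover have "(SUP i. emeasure M (?B \<inter> A i)) = emeasure M (\<Union>i. ?B \<inter> A i)"
    using A(4) by (intro SUP_emeasure_incseq) (auto simp: incseq_def)
  ultimately have "emeasure M ?B \<le> ennreal (c / b)"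
    using le by (metis SUP_least)
  then have fin: "emeasure M ?B < \<infinity>"
    using le_less_trans by fastforce
  \<comment> \<open>With finiteness established, the whole set may be taken as
    \<open>C\<close>.\<close>
  have lower: "b * measure M ?B \<le> c"
    unfolding c_def by (intro oscillation_finite_part f ab fin) auto
  have B_int: "integrable M (\<lambda>x. a * indicator ?B x)"
    using fin by (intro integrable_mult_right integrable_real_indicator) auto
  \<comment> \<open>The mirror image of the lower bound, now driven by the sums that fall far below
    \<open>n\<close> times \<open>a\<close>.\<close>
  let ?g = "\<lambda>x. a * indicator ?B x - f x * indicator ?B x"
  have "0 \<le> (\<integral>x. ?g x \<partial>M)"
  proof (rule maximal_ergodic_inequality)
    fix x assume "?g x \<noteq> 0"
    then have x: "x \<in> ?B" by (auto split: split_indicator_asm)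
    then obtain n where n: "birkhoff_sum f n x + real 0 < real n * a"
      unfolding oscillation_def by blast
    have "birkhoff_sum ?g n x = (\<Sum>j<n. a - f ((T ^^ j) x))"
      unfolding birkhoff_sum_def using oscillation_funpow[OF x]
      by (intro sum.cong) auto
    then have "0 < birkhoff_sum ?g n x"
      using n by (simp add: birkhoff_sum_def sum_subtractf)
    then show "\<exists>n. 0 < birkhoff_sum ?g n x" ..
  qed (intro Bochner_Integration.integrable_diff fB B_int)
  then have upper: "c \<le> a * measure M ?B"
    using fB B_int by (simp add: c_def)
  have "(b - a) * measure M ?B \<le> 0"
    using lower upper by (simp add: algebra_simps)
  then have "measure M ?B = 0"
    using ab by (simp add: mult_le_0_iff measure_le_0_iff)
  then show ?thesis
    using fin by (auto simp: null_sets_def emeasure_eq_ennreal_measure less_top)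
qed

text \<open>The strict gaps between the levels turn recurrent deviations of the averages into
  deviations of the sums of size at least \<open>n\<close> times the gap, which are
  unbounded.\<close>

lemma oscillationI:
  assumes x: "x \<in> space M" and ab: "a' < a" "b < b'"
    and low: "\<exists>\<^sub>F n in sequentially. birkhoff_average T f n x < a'"
    and high: "\<exists>\<^sub>F n in sequentially. b' < birkhoff_average T f n x"
  shows "x \<in> oscillation f a b"
proof -
  have "\<exists>n. birkhoff_sum f n x + real K < real n * a" for K :: nat
  proof -
    obtain L :: nat where L: "real K / (a - a') < real L"
      using reals_Archimedean2 by blast
    \<comment> \<open>Beyond \<open>L\<close> the gap contributes more than \<open>K\<close>;
      \<open>Suc\<close> keeps \<open>n\<close> positive, so that the average can be multiplied
      out.\<close>
    have "\<exists>n\<ge>Suc L. birkhoff_average T f n x < a'"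
      using low by (meson frequently_sequentially)
    then obtain n where n: "Suc L \<le> n" "birkhoff_average T f n x < a'" by blast
    have "real K < real L * (a - a')"
      using L ab by (simp add: field_simps)
    also have "\<dots> \<le> real n * (a - a')"
      using n ab by (intro mult_right_mono) auto
    finally have "real K < real n * (a - a')" .
    moreover have "birkhoff_sum f n x < real n * a'"
      using n by (simp add: birkhoff_average_eq field_simps)
    ultimately show ?thesis
      by (intro exI[of _ n]) (simp add: algebra_simps)
  qed
  moreover have "\<exists>n. real n * b + real K < birkhoff_sum f n x" for K :: nat
  proof -
    obtain L :: nat where L: "real K / (b' - b) < real L"
      using reals_Archimedean2 by blast
    have "\<exists>n\<ge>Suc L. b' < birkhoff_average T f n x"
      using high by (meson frequently_sequentially)
    then obtain n where n: "Suc L \<le> n" "b' < birkhoff_average T f n x" by blast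
    have "real K < real L * (b' - b)"
      using L ab by (simp add: field_simps)
    also have "\<dots> \<le> real n * (b' - b)"
      using n ab by (intro mult_right_mono) auto
    finally have "real K < real n * (b' - b)" .
    moreover have "real n * b' < birkhoff_sum f n x"
      using n by (simp add: birkhoff_average_eq field_simps)
    ultimately show ?thesis
      by (intro exI[of _ n]) (simp add: algebra_simps)
  qed
  ultimately show ?thesis
    using x by (simp add: oscillation_def)
qed

section \<open>Fatou bounds and a convergence criterion\<close>

lemma nn_integral_liminf_birkhoff_average:
  assumes f: "integrable M f" and nonneg: "AE x in M. 0 \<le> f x"
  shows "(\<integral>\<^sup>+x. liminf (\<lambda>n. ennreal (birkhoff_average T f n x)) \<partial>M)
    \<le> liminf (\<lambda>n. ennreal (\<integral>x. birkhoff_average T f n x \<partial>M))"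
proof -
  have [measurable]: "f \<in> borel_measurable M" using f by auto
  have "(\<integral>\<^sup>+x. ennreal (birkhoff_average T f n x) \<partial>M) = ennreal (\<integral>x. birkhoff_average T f n x \<partial>M)" for n
    using AE_birkhoff_average_nonneg[OF nonneg]
    by (intro nn_integral_eq_integral integrable_birkhoff_average f) auto
  then show ?thesis
    using nn_integral_liminf[of "\<lambda>n x. ennreal (birkhoff_average T f n x)" M] by simp
qed

text \<open>By Fatou's lemma the lower limit has integral at most that of \<open>f\<close>. This is
  what rules out averages tending to infinity.\<close>

lemma AE_liminf_birkhoff_average_finite:
  assumes f: "integrable M f" and nonneg: "AE x in M. 0 \<le> f x"
  shows "AE x in M. liminf (\<lambda>n. ennreal (birkhoff_average T f n x)) \<noteq> \<infinity>"
proof (rule nn_integral_noteq_infinite)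
  have [measurable]: "f \<in> borel_measurable M" using f by auto
  show "(\<lambda>x. liminf (\<lambda>n. ennreal (birkhoff_average T f n x))) \<in> borel_measurable M"
    by measurable
  have "liminf (\<lambda>n. ennreal (\<integral>x. birkhoff_average T f n x \<partial>M)) \<le> liminf (\<lambda>n::nat. ennreal (\<integral>x. f x \<partial>M))"
    by (intro Liminf_mono always_eventually allI ennreal_leI integral_birkhoff_average_le f nonneg)
  then show "(\<integral>\<^sup>+x. liminf (\<lambda>n. ennreal (birkhoff_average T f n x)) \<partial>M) \<noteq> \<infinity>"
    using nn_integral_liminf_birkhoff_average[OF f nonneg]
    by (auto simp: Liminf_const top_unique)
qed

end

text \<open>Divergence has two causes: a gap between lower and upper limit, which two rational
  levels detect, or the limit infinity, excluded by \<open>fin\<close>. Rational levels keep the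
  exceptional sets countable in number.\<close>

lemma convergent_if_no_oscillation:
  fixes u :: "nat \<Rightarrow> real"
  assumes nonneg: "\<And>n. 0 \<le> u n"
    and fin: "liminf (\<lambda>n. ennreal (u n)) \<noteq> \<infinity>"
    and no_osc: "\<And>a b. 0 < a \<Longrightarrow> a < b \<Longrightarrow> a \<in> \<rat> \<Longrightarrow> b \<in> \<rat> \<Longrightarrow>
      \<exists>\<^sub>F n in sequentially. u n < a \<Longrightarrow> \<exists>\<^sub>F n in sequentially. b < u n \<Longrightarrow> False"
  shows "convergent u"
proof -
  have le: "limsup (\<lambda>n. ereal (u n)) \<le> liminf (\<lambda>n. ereal (u n))"
  proof (rule ccontr)
    assume "\<not> ?thesis"
    then have less: "liminf (\<lambda>n. ereal (u n)) < limsup (\<lambda>n. ereal (u n))" by simp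
    obtain r where r: "liminf (\<lambda>n. ereal (u n)) < ereal r" "ereal r < limsup (\<lambda>n. ereal (u n))"
      using ereal_dense2[OF less] by blast
    obtain s where s: "ereal r < ereal s" "ereal s < limsup (\<lambda>n. ereal (u n))"
      using ereal_dense2[OF r(2)] by blast
    \<comment> \<open>Choosing the two levels on opposite sides of the midpoint guarantees
      \<open>a < b\<close>.\<close>
    obtain a where a: "a \<in> \<rat>" "r < a" "a < (r + s) / 2"
      using Rats_dense_in_real[of r "(r + s) / 2"] s by auto
    obtain b where b: "b \<in> \<rat>" "(r + s) / 2 < b" "b < s"
      using Rats_dense_in_real[of "(r + s) / 2" s] s by auto
    have low: "\<exists>\<^sub>F n in sequentially. u n < a"
    proof (rule ccontr)
      assume "\<not> ?thesis"
      then have "\<forall>\<^sub>F n in sequentially. ereal a \<le> ereal (u n)"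
        by (simp add: frequently_def not_less)
      then have "ereal a \<le> liminf (\<lambda>n. ereal (u n))" by (rule Liminf_bounded)
      then have "ereal a < ereal r" using r(1) by (rule le_less_trans)
      with a show False by simp
    qed
    have high: "\<exists>\<^sub>F n in sequentially. b < u n"
    proof (rule ccontr)
      assume "\<not> ?thesis"
      then have "\<forall>\<^sub>F n in sequentially. ereal (u n) \<le> ereal b"
        by (simp add: frequently_def not_less)
      then have "limsup (\<lambda>n. ereal (u n)) \<le> ereal b" by (rule Limsup_bounded)
      with s(2) have "ereal s < ereal b" by (rule less_le_trans)
      with b show False by simp
    qed
    obtain n where "u n < a" using low by (auto dest: frequently_ex)
    \<comment> \<open>A level with a nonnegative term strictly below it is positive; hence positive
      levels suffice in \<open>no_osc\<close>.\<close>
    then have "0 < a" using nonneg[of n] by linarith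
    then show False using no_osc[OF _ _ a(1) b(1) low high] a b by linarith
  qed
  have eq: "liminf (\<lambda>n. ereal (u n)) = limsup (\<lambda>n. ereal (u n))"
    using le Liminf_le_Limsup[of sequentially "\<lambda>n. ereal (u n)"] by simp
  define l where "l = liminf (\<lambda>n. ereal (u n))"
  have lim: "(\<lambda>n. ereal (u n)) \<longlonglongrightarrow> l"
    unfolding l_def using eq by (intro Liminf_eq_Limsup) auto
  have "0 \<le> l"
    unfolding l_def using nonneg by (intro Liminf_bounded) auto
  moreover have "l \<noteq> \<infinity>"
  proof
    assume "l = \<infinity>"
    \<comment> \<open>The limit is moved from \<open>ereal\<close> to \<open>ennreal\<close>, the
      type in which \<open>fin\<close> is stated.\<close>
    have "(\<lambda>n. e2ennreal (ereal (u n))) \<longlonglongrightarrow> e2ennreal l"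
      using lim by (rule tendsto_e2ennrealI)
    then have "(\<lambda>n. ennreal (u n)) \<longlonglongrightarrow> \<infinity>"
      using \<open>l = \<infinity>\<close> by (simp add: ennreal.abs_eq)
    then show False
      using lim_imp_Liminf[of sequentially "\<lambda>n. ennreal (u n)"] fin by simp
  qed
  ultimately obtain r where "l = ereal r" by (cases l) auto
  then have "u \<longlonglongrightarrow> r" using lim by simp
  then show ?thesis by (rule convergentI)
qed

section \<open>Existence, invariance and integrability of the limit\<close>

context half_invariant_map
begin

lemma AE_convergent_birkhoff_average:
  assumes M: "sigma_finite_measure M" and f: "integrable M f" and nonneg: "AE x in M. 0 \<le> f x"
  shows "AE x in M. convergent (\<lambda>n. birkhoff_average T f n x)"
proof -
  define N where "N = (\<Union>(a, b) \<in> {(a, b). a \<in> \<rat> \<and> b \<in> \<rat> \<and> 0 < b \<and> a < b}. oscillation f a b)"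
  have "countable {(a :: real, b :: real). a \<in> \<rat> \<and> b \<in> \<rat> \<and> 0 < b \<and> a < b}"
    by (rule countable_subset[of _ "\<rat> \<times> \<rat>"]) (auto simp: countable_rat)
  then have "N \<in> null_sets M"
    unfolding N_def using oscillation_null[OF M f] by (intro null_sets_UN') auto
  then have "AE x in M. x \<notin> N" by (rule AE_not_in)
  then show ?thesis
    using AE_birkhoff_average_nonneg[OF nonneg] AE_liminf_birkhoff_average_finite[OF f nonneg]
      AE_space
  proof eventually_elim
    case (elim x)
    show ?case
    proof (rule convergent_if_no_oscillation)
      fix a b :: real
      assume ab: "0 < a" "a < b"
        and osc: "\<exists>\<^sub>F n in sequentially. birkhoff_average T f n x < a"
          "\<exists>\<^sub>F n in sequentially. b < birkhoff_average T f n x"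
      \<comment> \<open>\<open>oscillationI\<close> loses a little at each level, so rational
        \<open>c < d\<close> are inserted strictly between \<open>a\<close> and
        \<open>b\<close>.\<close>
      obtain c where c: "c \<in> \<rat>" "a < c" "c < (a + b) / 2"
        using Rats_dense_in_real[of a "(a + b) / 2"] ab by auto
      obtain d where d: "d \<in> \<rat>" "(a + b) / 2 < d" "d < b"
        using Rats_dense_in_real[of "(a + b) / 2" b] ab by auto
      have "x \<in> oscillation f c d"
        using oscillationI[OF elim(4) c(2) d(3) osc] .
      then have "x \<in> N"
        unfolding N_def using c d ab by (intro UN_I[of "(c, d)"]) auto
      with elim(1) show False ..
    qed (use elim in auto)
  qed
qed

lemma AE_birkhoff_limit:
  assumes M: "sigma_finite_measure M" and f: "integrable M f" and nonneg: "AE x in M. 0 \<le> f x"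
  shows "AE x in M. (\<lambda>n. birkhoff_average T f n x) \<longlonglongrightarrow> birkhoff_limit T f x"
  using AE_convergent_birkhoff_average[OF assms]
  by eventually_elim (simp add: birkhoff_limit_def convergent_LIMSEQ_iff)

lemma AE_birkhoff_limit_nonneg:
  assumes M: "sigma_finite_measure M" and f: "integrable M f" and nonneg: "AE x in M. 0 \<le> f x"
  shows "AE x in M. 0 \<le> birkhoff_limit T f x"
  using AE_birkhoff_limit[OF assms] AE_birkhoff_average_nonneg[OF nonneg]
  by eventually_elim (auto intro: LIMSEQ_le_const)

text \<open>The averages at \<open>T x\<close> are those at \<open>x\<close>, shifted by one index
  and rescaled by a factor tending to 1, minus \<open>f x / real n\<close>. The argument is
  pointwise and involves no null sets.\<close>

lemma birkhoff_average_T_tendsto: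
  assumes lim: "(\<lambda>n. birkhoff_average T f n x) \<longlonglongrightarrow> l"
  shows "(\<lambda>n. birkhoff_average T f n (T x)) \<longlonglongrightarrow> l"
proof -
  have "(\<lambda>n. real (Suc n) / real n * birkhoff_average T f (Suc n) x - f x / real n) \<longlonglongrightarrow> 1 * l - 0"
  proof (intro tendsto_diff tendsto_mult)
    show "(\<lambda>n. real (Suc n) / real n) \<longlonglongrightarrow> 1"
      by (rule LIMSEQ_Suc_n_over_n)
    show "(\<lambda>n. birkhoff_average T f (Suc n) x) \<longlonglongrightarrow> l"
      using lim by (rule LIMSEQ_Suc)
    show "(\<lambda>n. f x / real n) \<longlonglongrightarrow> 0"
      by (rule lim_const_over_n)
  qed
  \<comment> \<open>For \<open>n = 0\<close> both sides are 0 by the convention on division.\<close>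
  moreover have "real (Suc n) / real n * birkhoff_average T f (Suc n) x - f x / real n =
      birkhoff_average T f n (T x)" for n
    by (simp add: birkhoff_average_eq birkhoff_sum_Suc diff_divide_distrib[symmetric])
  ultimately show ?thesis by simp
qed

lemma nn_integral_birkhoff_limit_le:
  assumes M: "sigma_finite_measure M" and f: "integrable M f" and nonneg: "AE x in M. 0 \<le> f x"
  shows "(\<integral>\<^sup>+x. ennreal (birkhoff_limit T f x) \<partial>M)
    \<le> liminf (\<lambda>n. ennreal (\<integral>x. birkhoff_average T f n x \<partial>M))"
proof -
  have "AE x in M. ennreal (birkhoff_limit T f x) = liminf (\<lambda>n. ennreal (birkhoff_average T f n x))"
    using AE_birkhoff_limit[OF assms]
  proof eventually_elim
    case (elim x)
    then show ?case
      using lim_imp_Liminf[OF _ tendsto_ennrealI[OF elim]] by simp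
  qed
  then have "(\<integral>\<^sup>+x. ennreal (birkhoff_limit T f x) \<partial>M) =
      (\<integral>\<^sup>+x. liminf (\<lambda>n. ennreal (birkhoff_average T f n x)) \<partial>M)"
    by (rule nn_integral_cong_AE)
  then show ?thesis
    using nn_integral_liminf_birkhoff_average[OF f nonneg] by simp
qed

lemma integrable_birkhoff_limit:
  assumes M: "sigma_finite_measure M" and f: "integrable M f" and nonneg: "AE x in M. 0 \<le> f x"
  shows "integrable M (birkhoff_limit T f)"
proof (rule integrableI_nonneg)
  have [measurable]: "f \<in> borel_measurable M" using f by auto
  show "birkhoff_limit T f \<in> borel_measurable M" by measurable
  have "liminf (\<lambda>n. ennreal (\<integral>x. birkhoff_average T f n x \<partial>M)) \<le> liminf (\<lambda>n::nat. ennreal (\<integral>x. f x \<partial>M))"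
    by (intro Liminf_mono always_eventually allI ennreal_leI integral_birkhoff_average_le f nonneg)
  then show "(\<integral>\<^sup>+x. ennreal (birkhoff_limit T f x) \<partial>M) < \<infinity>"
    using nn_integral_birkhoff_limit_le[OF assms]
    by (auto simp: Liminf_const less_top[symmetric] top_unique)
qed (rule AE_birkhoff_limit_nonneg[OF assms])

text \<open>Fatou's inequality is carried from \<open>ennreal\<close> to \<open>ereal\<close>
  through the description of a lower limit by its strict lower bounds.\<close>

lemma integral_birkhoff_limit_le_liminf:
  assumes M: "sigma_finite_measure M" and f: "integrable M f" and nonneg: "AE x in M. 0 \<le> f x"
  shows "ereal (\<integral>x. birkhoff_limit T f x \<partial>M) \<le> liminf (\<lambda>n. ereal (\<integral>x. birkhoff_average T f n x \<partial>M))"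
proof -
  define I where "I = (\<integral>x. birkhoff_limit T f x \<partial>M)"
  define c where "c n = (\<integral>x. birkhoff_average T f n x \<partial>M)" for n
  have "ennreal I = (\<integral>\<^sup>+x. ennreal (birkhoff_limit T f x) \<partial>M)"
    unfolding I_def
    by (intro nn_integral_eq_integral[symmetric] integrable_birkhoff_limit AE_birkhoff_limit_nonneg assms)
  then have le: "ennreal I \<le> liminf (\<lambda>n. ennreal (c n))"
    unfolding c_def using nn_integral_birkhoff_limit_le[OF assms] by simp
  have c_nonneg: "0 \<le> c n" for n
    unfolding c_def using AE_birkhoff_average_nonneg[OF nonneg] by (intro integral_nonneg_AE) auto
  have "\<forall>\<^sub>F n in sequentially. y < ereal (c n)" if y: "y < ereal I" for y
  proof (cases "0 \<le> y")
    case True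
    with y obtain r where r: "y = ereal r" "0 \<le> r" "r < I" by (cases y) auto
    then have "ennreal r < ennreal I" by (simp add: ennreal_lessI)
    with le have "\<forall>\<^sub>F n in sequentially. ennreal r < ennreal (c n)"
      by (simp add: le_Liminf_iff)
    then show ?thesis
      by eventually_elim (use r in \<open>simp add: ennreal_less_iff\<close>)
  next
    \<comment> \<open>Negative bounds have no counterpart in \<open>ennreal\<close>, but lie below
      every \<open>c n\<close>.\<close>
    case False
    then have "y < ereal (c n)" for n
      using c_nonneg[of n] by (metis ereal_less_eq(5) less_le_trans not_le)
    then show ?thesis by simp
  qed
  then show ?thesis
    unfolding le_Liminf_iff I_def[symmetric] c_def[symmetric] by blast
qed

end

subsection \<open>Finite measures\<close>

locale finite_half_invariant_map = half_invariant_map + finite_measure M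
begin

text \<open>Half-invariance for a set and for its complement sum to an equality.\<close>

lemma emeasure_vimage_T:
  assumes B: "B \<in> sets M"
  shows "emeasure M (T -` B \<inter> space M) = emeasure M B"
proof -
  have le: "measure M (T -` A \<inter> space M) \<le> measure M A" if "A \<in> sets M" for A
    using half_invariant that by (auto simp: half_invariant_def emeasure_eq_measure)
  have "T -` (space M - B) \<inter> space M = space M - (T -` B \<inter> space M)"
    using T_space by auto
  then have "measure M (space M) - measure M (T -` B \<inter> space M) \<le> measure M (space M) - measure M B"
    using le[of "space M - B"] B by (simp add: finite_measure_compl measurable_sets[OF T_measurable])
  with le[OF B] show ?thesis by (simp add: emeasure_eq_measure)
qed

lemma integral_comp:
  fixes g :: "'a \<Rightarrow> real"
  assumes [measurable]: "g \<in> borel_measurable M"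
  shows "(\<integral>x. g (T x) \<partial>M) = (\<integral>x. g x \<partial>M)"
proof -
  have "distr M M T = M"
    by (rule measure_eqI) (auto simp: emeasure_distr emeasure_vimage_T)
  then show ?thesis
    using integral_distr[OF T_measurable, of g] by simp
qed

lemma integral_funpow:
  fixes g :: "'a \<Rightarrow> real"
  assumes [measurable]: "g \<in> borel_measurable M"
  shows "(\<integral>x. g ((T ^^ j) x) \<partial>M) = (\<integral>x. g x \<partial>M)"
proof (induction j)
  case (Suc j)
  then show ?case
    using integral_comp[of "\<lambda>x. g ((T ^^ j) x)"] by (simp add: funpow_swap1)
qed simp

lemma integral_birkhoff_average_eq:
  assumes g: "integrable M g" and n: "0 < n"
  shows "(\<integral>x. birkhoff_average T g n x \<partial>M) = (\<integral>x. g x \<partial>M)"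
proof -
  have "g \<in> borel_measurable M" using g by auto
  then show ?thesis
    using n by (simp add: integral_birkhoff_average[OF g] integral_funpow)
qed

lemma integral_birkhoff_average_tendsto:
  assumes "integrable M g"
  shows "(\<lambda>n. \<integral>x. birkhoff_average T g n x \<partial>M) \<longlonglongrightarrow> (\<integral>x. g x \<partial>M)"
  by (intro tendsto_eventually eventually_mono[OF eventually_gt_at_top[of 0]]
      integral_birkhoff_average_eq assms)

text \<open>On a finite measure space the constant bound is integrable and dominates every average,
  so the limit inherits the common integral of the averages.\<close>

lemma integral_birkhoff_limit_bounded:
  assumes [measurable]: "g \<in> borel_measurable M"
    and bounds: "AE x in M. 0 \<le> g x" "AE x in M. g x \<le> K"
  shows "(\<integral>x. birkhoff_limit T g x \<partial>M) = (\<integral>x. g x \<partial>M)"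
proof -
  have g: "integrable M g"
  proof (rule integrable_const_bound)
    show "AE x in M. norm (g x) \<le> K" using bounds by eventually_elim simp
  qed simp
  \<comment> \<open>The absolute value covers a negative \<open>K\<close>, which is possible when
    the whole space is null.\<close>
  have upper: "AE x in M. \<forall>j. \<bar>g ((T ^^ j) x)\<bar> \<le> \<bar>K\<bar>"
  proof -
    have "AE x in M. \<bar>g x\<bar> \<le> \<bar>K\<bar>" using bounds by eventually_elim simp
    from AE_funpow[OF this] show ?thesis by (simp add: AE_all_countable)
  qed
  have "(\<lambda>n. \<integral>x. birkhoff_average T g n x \<partial>M) \<longlonglongrightarrow> (\<integral>x. birkhoff_limit T g x \<partial>M)"
  proof (rule integral_dominated_convergence)
    show "integrable M (\<lambda>x. \<bar>K\<bar>)" by simp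
    show "AE x in M. (\<lambda>n. birkhoff_average T g n x) \<longlonglongrightarrow> birkhoff_limit T g x"
      by (rule AE_birkhoff_limit[OF sigma_finite_measure_axioms g bounds(1)])
    show "AE x in M. norm (birkhoff_average T g n x) \<le> \<bar>K\<bar>" for n
      using upper
    proof eventually_elim
      case (elim x)
      have "\<bar>birkhoff_sum g n x\<bar> \<le> (\<Sum>j<n. \<bar>K\<bar>)"
        unfolding birkhoff_sum_def by (rule order_trans[OF sum_abs sum_mono]) (use elim in auto)
      then show ?case
        by (cases "n = 0") (auto simp: birkhoff_average_eq field_simps)
    qed
  qed simp_all
  then show ?thesis
    using integral_birkhoff_average_tendsto[OF g] LIMSEQ_unique by blast
qed

text \<open>Fatou gives one inequality. For the other, truncations of \<open>f\<close> obey the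
  bounded case, their limits lie below that of \<open>f\<close>, and their integrals tend to that of
  \<open>f\<close>.\<close>

lemma integral_birkhoff_limit_eq:
  assumes f: "integrable M f" and nonneg: "AE x in M. 0 \<le> f x"
  shows "(\<integral>x. birkhoff_limit T f x \<partial>M) = (\<integral>x. f x \<partial>M)"
proof (rule antisym)
  have [measurable]: "f \<in> borel_measurable M" using f by auto
  note sf = sigma_finite_measure_axioms
  define g where "g k x = min (f x) (real k)" for k x
  have g_meas [measurable]: "g k \<in> borel_measurable M" for k
    unfolding g_def[abs_def] by measurable
  have g_nonneg: "AE x in M. 0 \<le> g k x" for k
    using nonneg by eventually_elim (simp add: g_def)
  have g: "integrable M (g k)" for k
  proof (rule Bochner_Integration.integrable_bound[OF f])
    show "AE x in M. norm (g k x) \<le> norm (f x)"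
      using nonneg by eventually_elim (simp add: g_def)
  qed simp
  have "(\<integral>x. g k x \<partial>M) \<le> (\<integral>x. birkhoff_limit T f x \<partial>M)" for k
  proof -
    have "(\<integral>x. g k x \<partial>M) = (\<integral>x. birkhoff_limit T (g k) x \<partial>M)"
      by (rule integral_birkhoff_limit_bounded[symmetric, OF _ g_nonneg, of _ "real k"])
        (auto simp: g_def)
    also have "\<dots> \<le> (\<integral>x. birkhoff_limit T f x \<partial>M)"
    proof (rule integral_mono_AE)
      show "AE x in M. birkhoff_limit T (g k) x \<le> birkhoff_limit T f x"
        using AE_birkhoff_limit[OF sf g[of k] g_nonneg] AE_birkhoff_limit[OF sf f nonneg]
      proof eventually_elim
        case (elim x)
        have "birkhoff_average T (g k) n x \<le> birkhoff_average T f n x" for n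
          unfolding birkhoff_average_def by (intro mult_left_mono sum_mono) (auto simp: g_def)
        then show ?case using LIMSEQ_le[OF elim] by blast
      qed
    qed (intro integrable_birkhoff_limit sf g f g_nonneg nonneg)+
    finally show ?thesis .
  qed
  moreover have "(\<lambda>k. \<integral>x. g k x \<partial>M) \<longlonglongrightarrow> (\<integral>x. f x \<partial>M)"
  proof (rule integral_dominated_convergence)
    show "integrable M (\<lambda>x. \<bar>f x\<bar>)" using f by simp
    show "AE x in M. (\<lambda>k. g k x) \<longlonglongrightarrow> f x"
    proof (rule AE_I2)
      fix x
      obtain k0 :: nat where "f x < real k0" using reals_Archimedean2 by blast
      then have "\<forall>\<^sub>F k in sequentially. g k x = f x"
        by (intro eventually_sequentiallyI[of k0]) (auto simp: g_def)
      then show "(\<lambda>k. g k x) \<longlonglongrightarrow> f x" by (rule tendsto_eventually)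
    qed
    show "AE x in M. norm (g k x) \<le> \<bar>f x\<bar>" for k
      using nonneg by eventually_elim (simp add: g_def)
  qed simp_all
  ultimately show "(\<integral>x. f x \<partial>M) \<le> (\<integral>x. birkhoff_limit T f x \<partial>M)"
    by (intro LIMSEQ_le_const2) auto
  \<comment> \<open>The integrals of the averages are constant from \<open>n = 1\<close> on, so the
    lower limit in the Fatou bound is the integral of \<open>f\<close>.\<close>
  have "(\<lambda>n. ereal (\<integral>x. birkhoff_average T f n x \<partial>M)) \<longlonglongrightarrow> ereal (\<integral>x. f x \<partial>M)"
    using integral_birkhoff_average_tendsto[OF f] by simp
  from lim_imp_Liminf[OF _ this]
  show "(\<integral>x. birkhoff_limit T f x \<partial>M) \<le> (\<integral>x. f x \<partial>M)"
    using integral_birkhoff_limit_le_liminf[OF sf f nonneg] by simp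
qed

end

section \<open>The ergodic theorem for half-invariant sigma-finite measures\<close>

theorem theorem1p2:
  fixes M :: "'a measure" and T :: "'a \<Rightarrow> 'a" and f :: "'a \<Rightarrow> real"
  assumes "sigma_finite_measure M"
    and "T \<in> M \<rightarrow>\<^sub>M M"
    and "half_invariant M T"
    and "integrable M f"
    and "AE x in M. 0 \<le> f x"
  shows "(AE x in M. convergent (\<lambda>n. birkhoff_average T f n x))
    \<and> (integrable M (birkhoff_limit T f)
       \<and> (AE x in M. birkhoff_limit T f (T x) = birkhoff_limit T f x))
    \<and> (ereal (\<integral>x. birkhoff_limit T f x \<partial>M)
         \<le> liminf (\<lambda>n. ereal (1 / real n * (\<Sum>j<n. \<integral>x. f ((T ^^ j) x) \<partial>M)))
       \<and> liminf (\<lambda>n. ereal (1 / real n * (\<Sum>j<n. \<integral>x. f ((T ^^ j) x) \<partial>M)))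
         \<le> ereal (\<integral>x. f x \<partial>M))
    \<and> (emeasure M (space M) < \<infinity> \<longrightarrow>
         (\<lambda>n. 1 / real n * (\<Sum>j<n. \<integral>x. f ((T ^^ j) x) \<partial>M))
           \<longlonglongrightarrow> (\<integral>x. birkhoff_limit T f x \<partial>M)
         \<and> (\<integral>x. birkhoff_limit T f x \<partial>M) = (\<integral>x. f x \<partial>M))
    \<and> (emeasure M (space M) < \<infinity> \<longrightarrow> invariant_measure M T)"
proof -
  interpret half_invariant_map M T
    using assms(2,3) by (rule half_invariant_map.intro)
  \<comment> \<open>This direction turns the averages of integrals in the goal into integrals of
    averages.\<close>
  note avg = integral_birkhoff_average[OF assms(4), symmetric]
  have "AE x in M. birkhoff_limit T f (T x) = birkhoff_limit T f x"
    using AE_birkhoff_limit[OF assms(1,4,5)]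
  proof eventually_elim
    case (elim x)
    from limI[OF birkhoff_average_T_tendsto[OF this]] show ?case
      by (simp add: birkhoff_limit_def)
  qed
  moreover have "liminf (\<lambda>n. ereal (\<integral>x. birkhoff_average T f n x \<partial>M)) \<le> ereal (\<integral>x. f x \<partial>M)"
  proof -
    have "liminf (\<lambda>n. ereal (\<integral>x. birkhoff_average T f n x \<partial>M)) \<le> liminf (\<lambda>n::nat. ereal (\<integral>x. f x \<partial>M))"
      using integral_birkhoff_average_le[OF assms(4,5)]
      by (intro Liminf_mono always_eventually) simp
    then show ?thesis by (simp add: Liminf_const)
  qed
  moreover have "(\<lambda>n. \<integral>x. birkhoff_average T f n x \<partial>M) \<longlonglongrightarrow> (\<integral>x. birkhoff_limit T f x \<partial>M)
      \<and> (\<integral>x. birkhoff_limit T f x \<partial>M) = (\<integral>x. f x \<partial>M) \<and> invariant_measure M T"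
    if "emeasure M (space M) < \<infinity>"
  proof -
    interpret finite_half_invariant_map M T
      using that by (intro finite_half_invariant_map.intro half_invariant_map_axioms finite_measureI) simp
    show ?thesis
      using integral_birkhoff_average_tendsto[OF assms(4)] integral_birkhoff_limit_eq[OF assms(4,5)]
      by (auto simp: invariant_measure_def emeasure_vimage_T)
  qed
  ultimately show ?thesis
    using AE_convergent_birkhoff_average[OF assms(1,4,5)] integrable_birkhoff_limit[OF assms(1,4,5)]
      integral_birkhoff_limit_le_liminf[OF assms(1,4,5)]
    unfolding avg by (intro conjI impI) blast+
qed

end
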